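(* There exists $N_0$ such that for every integer $N \ge N_0$ one has $$\operatorname{Card}\{\, n \text{ a positive integer} : n \le N,\ |s_3(n) - s_2(n)| \le 0.1457205\, \log n \,\} \;>\; N^{0.970359}.$$
   Context: For integers $b \ge 2$ and $n \ge 0$, $s_b(n)$ denotes the sum of the digits of $n$ in base $b$: $s_b(n) = \sum_{j\ge 0} \varepsilon_j$, where $n = \sum_{j \ge 0} \varepsilon_j b^j$ with $\varepsilon_j \in \{0,1,\ldots,b-1\}$ for all $j$. $\log$ is the natural logarithm, and $\operatorname{Card}$ denotes the cardinality of a finite set. The decimal constants are exact rational numbers. *)

theory Defs
  imports Complex_Main
begin

(* Digits are indexed by all natural positions, lowest first; the finite-support condition is the
   convergence of the series over the naturals and makes the sum below the intended finite one. *)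
definition is_base_expansion :: "nat \<Rightarrow> nat \<Rightarrow> (nat \<Rightarrow> nat) \<Rightarrow> bool" where
  "is_base_expansion b n e \<longleftrightarrow>
     (\<forall>j. e j \<in> {0..b - 1}) \<and> finite {j. e j \<noteq> 0} \<and> n = (\<Sum>j | e j \<noteq> 0. e j * b ^ j)"

(* For b >= 2 the expansion exists and is unique (ex1_base_expansion below); smaller bases are
   meaningless. *)
definition base_digits :: "nat \<Rightarrow> nat \<Rightarrow> nat \<Rightarrow> nat" where
  "base_digits b n = (THE e. is_base_expansion b n e)"

definition digit_sum :: "nat \<Rightarrow> nat \<Rightarrow> nat" where
  "digit_sum b n = (\<Sum>j | base_digits b n j \<noteq> 0. base_digits b n j)"

lemma finite_support_bound:
  fixes e :: "nat \<Rightarrow> nat"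
  assumes "finite {j. e j \<noteq> 0}"
  obtains k where "{j. e j \<noteq> 0} \<subseteq> {..<k}"
  using assms finite_nat_set_iff_bounded by (metis lessThan_iff subsetI)

lemma is_base_expansion_sum_lessThan:
  assumes "is_base_expansion b n e" "{j. e j \<noteq> 0} \<subseteq> {..<k}"
  shows "n = (\<Sum>j<k. e j * b ^ j)"
proof -
  have "(\<Sum>j | e j \<noteq> 0. e j * b ^ j) = (\<Sum>j<k. e j * b ^ j)"
    using assms(2) by (intro sum.mono_neutral_left) auto
  then show ?thesis using assms(1) unfolding is_base_expansion_def by metis
qed

lemma is_base_expansion_digit:
  assumes "b \<ge> 2" "is_base_expansion b n e"
  shows "e j = n div b ^ j mod b"
  using assms(2)
proof (induction j arbitrary: n e)
  case (0 n e)
  obtain k where k: "{j. e j \<noteq> 0} \<subseteq> {..<k}"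
    using 0 finite_support_bound unfolding is_base_expansion_def by blast
  have "n = (\<Sum>j<Suc k. e j * b ^ j)"
    using k by (intro is_base_expansion_sum_lessThan[OF 0]) auto
  also have "\<dots> = e 0 + b * (\<Sum>j<k. e (Suc j) * b ^ j)"
    by (subst sum.lessThan_Suc_shift) (simp add: sum_distrib_left ac_simps)
  finally have "n mod b = e 0 mod b" by simp
  moreover have "e 0 < b" using 0 assms(1) unfolding is_base_expansion_def
    by (metis One_nat_def Suc_le_eq Suc_pred atLeastAtMost_iff le_imp_less_Suc
        less_le_trans pos2)
  ultimately show ?case by simp
next
  case (Suc j n e)
  define f where "f = (\<lambda>j. e (Suc j))"
  obtain k where k: "{j. e j \<noteq> 0} \<subseteq> {..<k}"
    using Suc.prems finite_support_bound unfolding is_base_expansion_def by blast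
  have kf: "{j. f j \<noteq> 0} \<subseteq> {..<k}"
    using k by (fastforce simp: f_def subset_iff dest: Suc_lessD)
  have n: "n = (\<Sum>j<Suc k. e j * b ^ j)"
    using k by (intro is_base_expansion_sum_lessThan[OF Suc.prems]) auto
  also have "\<dots> = e 0 + b * (\<Sum>j<k. f j * b ^ j)"
    by (subst sum.lessThan_Suc_shift) (simp add: f_def sum_distrib_left ac_simps)
  also have "(\<Sum>j<k. f j * b ^ j) = (\<Sum>j | f j \<noteq> 0. f j * b ^ j)"
    using kf by (intro sum.mono_neutral_right) auto
  finally have "n = e 0 + b * (\<Sum>j | f j \<noteq> 0. f j * b ^ j)" .
  moreover have e: "e i \<in> {0..b - 1}" for i
    using Suc.prems unfolding is_base_expansion_def by blast
  moreover have "e 0 < b" using e[of 0] assms(1) by simp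
  ultimately have "n div b = (\<Sum>j | f j \<noteq> 0. f j * b ^ j)" by simp
  then have "is_base_expansion b (n div b) f"
    unfolding is_base_expansion_def using e finite_subset[OF kf] by (auto simp: f_def)
  from Suc.IH[OF this] show ?case by (simp add: f_def div_mult2_eq)
qed

lemma sum_base_digits_mod:
  fixes b n :: nat
  shows "(\<Sum>j<k. (n div b ^ j mod b) * b ^ j) = n mod b ^ k"
proof (induction k)
  case (Suc k)
  have "n mod b ^ Suc k = n mod (b ^ k * b)" by (simp add: mult.commute)
  also have "\<dots> = b ^ k * (n div b ^ k mod b) + n mod b ^ k" by (rule mod_mult2_eq)
  finally show ?case using Suc by (simp add: mult.commute)
qed simp

lemma is_base_expansion_div_mod:
  assumes "b \<ge> 2"
  shows "is_base_expansion b n (\<lambda>j. n div b ^ j mod b)"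
proof -
  let ?e = "\<lambda>j. n div b ^ j mod b"
  have lt: "n < b ^ n" using assms by (simp add: power_gt_expt)
  have sub: "{j. ?e j \<noteq> 0} \<subseteq> {..<n}"
  proof
    fix j assume "j \<in> {j. ?e j \<noteq> 0}"
    then have nz: "n div b ^ j \<noteq> 0" by (auto intro: ccontr)
    show "j \<in> {..<n}"
    proof (rule ccontr)
      assume "j \<notin> {..<n}"
      then have "b ^ n \<le> b ^ j" using assms by (intro power_increasing) auto
      with lt nz show False by simp
    qed
  qed
  have "(\<Sum>j | ?e j \<noteq> 0. ?e j * b ^ j) = (\<Sum>j<n. ?e j * b ^ j)"
    using sub by (intro sum.mono_neutral_left) auto
  also have "\<dots> = n" using lt by (simp add: sum_base_digits_mod)
  moreover have "?e j \<in> {0..b - 1}" for j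
  proof -
    have "?e j < b" using assms by simp
    then show ?thesis by simp
  qed
  ultimately show ?thesis
    unfolding is_base_expansion_def using finite_subset[OF sub] by simp
qed

lemma ex1_base_expansion:
  assumes "b \<ge> 2"
  shows "\<exists>!e. is_base_expansion b n e"
  using is_base_expansion_digit[OF assms] is_base_expansion_div_mod[OF assms]
  by (intro ex1I) blast+

lemma is_base_expansion_base_digits:
  assumes "b \<ge> 2"
  shows "is_base_expansion b n (base_digits b n)"
  unfolding base_digits_def by (rule theI'[OF ex1_base_expansion[OF assms]])

lemma base_digits_eq:
  assumes "b \<ge> 2"
  shows "base_digits b n j = n div b ^ j mod b"
  by (rule is_base_expansion_digit[OF assms is_base_expansion_base_digits[OF assms]])

end

theory Submission
  imports Defs "HOL-Analysis.Harmonic_Numbers" "HOL-Real_Asymp.Real_Asymp"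
begin

text \<open>
  Only the marginal distributions of the two digit sums are used. Ternary digit strings of length
  \<open>Q M\<close> with \<open>a M\<close> zeros, \<open>b M\<close> ones and \<open>g M\<close> twos are counted from below by a multinomial
  coefficient. Their digit sum \<open>(b + 2 g) M\<close> is chosen to be the typical binary digit sum
  \<open>P M / 2\<close> of integers of the same size, where \<open>3 ^ Q\<close> is just below \<open>2 ^ P\<close>. By a Chernoff bound,
  exponentially fewer integers have a binary digit sum further than \<open>c * ln n\<close> from \<open>P M / 2\<close>,
  so almost all of those strings, preceded by a leading digit 1, give integers in the required set.
\<close>

section \<open>Splitting off the leading digit\<close>

lemma digit_sum_eq_sum_lessThan:
  assumes "b \<ge> 2" "n < b ^ k"
  shows "digit_sum b n = (\<Sum>j<k. n div b ^ j mod b)"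
proof -
  have "n < b ^ j" if "j \<ge> k" for j
    using assms power_increasing[OF that, of b] by linarith
  then have "j < k" if "base_digits b n j \<noteq> 0" for j
    using that assms(1) by (metis base_digits_eq div_less mod_0 not_less)
  then have "digit_sum b n = (\<Sum>j<k. base_digits b n j)"
    unfolding digit_sum_def by (intro sum.mono_neutral_left) auto
  then show ?thesis by (simp add: base_digits_eq[OF assms(1)])
qed

lemma digit_sum_leading:
  assumes "b \<ge> 2" "d < b" "r < b ^ k"
  shows "digit_sum b (d * b ^ k + r) = d + digit_sum b r"
proof -
  have "d * b ^ k + r < Suc d * b ^ k" using assms(3) by simp
  also have "\<dots> \<le> b ^ Suc k" using assms(2) by (simp del: mult_Suc)
  finally have lt: "d * b ^ k + r < b ^ Suc k" .
  have "(d * b ^ k + r) div b ^ j mod b = r div b ^ j mod b" if "j < k" for j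
  proof -
    \<comment> \<open>The spare factor \<open>b\<close> makes the contribution of the leading digit
      to position \<open>j\<close> vanish modulo \<open>b\<close>.\<close>
    have "d * b ^ k = (d * b ^ (k - j - 1) * b) * b ^ j"
      using that by (simp add: power_add[symmetric] power_Suc[symmetric] ac_simps del: power_Suc)
    then have "(d * b ^ k + r) div b ^ j = d * b ^ (k - j - 1) * b + r div b ^ j"
      by (metis assms(1) div_mult_self3 not_numeral_le_zero power_eq_0_iff)
    then show ?thesis by simp
  qed
  moreover have "(d * b ^ k + r) div b ^ k mod b = d"
    using assms by simp
  ultimately show ?thesis
    using digit_sum_eq_sum_lessThan[OF assms(1) lt] digit_sum_eq_sum_lessThan[OF assms(1,3)]
    by simp
qed

text \<open>The range splits into \<open>b\<close> blocks by leading digit, zero included. Since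
  \<open>f\<close> takes values in any commutative monoid, this serves both for generating functions
  and, with indicators, for counting.\<close>

lemma sum_digit_sum_lessThan_Suc:
  fixes f :: "nat \<Rightarrow> 'a :: comm_monoid_add"
  assumes "b \<ge> 2"
  shows "(\<Sum>n<b ^ Suc k. f (digit_sum b n)) = (\<Sum>d<b. \<Sum>r<b ^ k. f (d + digit_sum b r))"
proof -
  have "(\<Sum>n<b ^ Suc k. f (digit_sum b n)) =
      (\<Sum>d<b. \<Sum>n=d * b ^ k..<d * b ^ k + b ^ k. f (digit_sum b n))"
    by (simp add: sum.nat_group)
  also have "\<dots> = (\<Sum>d<b. \<Sum>r<b ^ k. f (d + digit_sum b r))"
  proof (rule sum.cong[OF refl])
    fix d assume "d \<in> {..<b}"
    then have "f (digit_sum b (r + d * b ^ k)) = f (d + digit_sum b r)" if "r < b ^ k" for r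
      using digit_sum_leading[OF assms _ that, of d] by (simp add: add.commute)
    then show "(\<Sum>n=d * b ^ k..<d * b ^ k + b ^ k. f (digit_sum b n)) =
        (\<Sum>r<b ^ k. f (d + digit_sum b r))"
      using sum.shift_bounds_nat_ivl[of "\<lambda>n. f (digit_sum b n)" 0 "d * b ^ k" "b ^ k"]
      by (simp add: add.commute atLeast0LessThan)
  qed
  finally show ?thesis .
qed

text \<open>With leading zeros allowed, the \<open>k\<close> digits vary independently, so the
  generating function of the digit sum factorises.\<close>

lemma sum_power_digit_sum:
  fixes y :: "'a :: comm_semiring_1"
  assumes "b \<ge> 2"
  shows "(\<Sum>n<b ^ k. y ^ digit_sum b n) = (\<Sum>d<b. y ^ d) ^ k"
proof (induction k)
  case 0
  show ?case using digit_sum_eq_sum_lessThan[OF assms, of 0 0] by simp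
next
  case (Suc k)
  show ?case
    unfolding sum_digit_sum_lessThan_Suc[OF assms, where f = "\<lambda>t. y ^ t"]
    by (simp add: power_add Suc flip: sum_distrib_left sum_distrib_right)
qed

section \<open>Ternary strings with a prescribed digit sum\<close>

lemma card_digit_sum_Suc:
  assumes "b \<ge> 2"
  shows "card {n. n < b ^ Suc k \<and> digit_sum b n = s} =
    (\<Sum>d<b. card {r. r < b ^ k \<and> d + digit_sum b r = s})"
proof -
  have card: "card {n. n < m \<and> P n} = (\<Sum>n<m. of_bool (P n))" for m :: nat and P
    by (simp add: of_bool_def sum.If_cases Int_def)
  show ?thesis
    unfolding card using sum_digit_sum_lessThan_Suc[OF assms, where f = "\<lambda>t. of_bool (t = s)"] .
qed

text \<open>Pascal's recursion for multinomial coefficients, by leading digit and cleared of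
  denominators. In general it is only an inequality, since different digit counts can share a digit
  sum.\<close>

lemma multinomial_le_card_ternary:
  "fact (a + b + c) \<le>
    card {n. n < 3 ^ (a + b + c) \<and> digit_sum 3 n = b + 2 * c} * (fact a * fact b * fact c)"
proof (induction "a + b + c" arbitrary: a b c)
  case 0
  have "{n. n = 0 \<and> digit_sum 3 n = 0} = {0}"
    using digit_sum_eq_sum_lessThan[of 3 0 0] by auto
  with 0 show ?case by simp
next
  case (Suc k)
  let ?T = "\<lambda>s d. card {n. n < 3 ^ k \<and> d + digit_sum 3 n = s}"
  let ?s = "b + 2 * c" and ?F = "fact a * fact b * fact c :: nat"
  have IH: "fact k \<le> ?T (b' + 2 * c') 0 * (fact a' * fact b' * fact c')"
    if "k = a' + b' + c'" for a' b' c'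
    using Suc.hyps(1)[OF that] that by simp
  \<comment> \<open>Strings with leading digit 0: the left side vanishes if \<open>a = 0\<close>;
    otherwise the induction hypothesis with one zero fewer is multiplied by \<open>a\<close>.
    Leading digits 1 and 2 are treated alike.\<close>
  have a: "a * fact k \<le> ?T ?s 0 * ?F"
  proof (cases a)
    case (Suc a')
    with Suc.hyps(2) have "fact k \<le> ?T ?s 0 * (fact a' * fact b * fact c)"
      by (intro IH) simp
    from mult_left_mono[OF this, of a] Suc show ?thesis by (simp add: algebra_simps)
  qed simp
  have b: "b * fact k \<le> ?T ?s 1 * ?F"
  proof (cases b)
    case (Suc b')
    with Suc.hyps(2) have "fact k \<le> ?T (b' + 2 * c) 0 * (fact a * fact b' * fact c)"
      by (intro IH) simp
    moreover have "?T (b' + 2 * c) 0 = ?T ?s 1" using Suc by simp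
    ultimately have "fact k \<le> ?T ?s 1 * (fact a * fact b' * fact c)" by metis
    from mult_left_mono[OF this, of b] Suc show ?thesis by (simp add: algebra_simps)
  qed simp
  have c: "c * fact k \<le> ?T ?s 2 * ?F"
  proof (cases c)
    case (Suc c')
    with Suc.hyps(2) have "fact k \<le> ?T (b + 2 * c') 0 * (fact a * fact b * fact c')"
      by (intro IH) simp
    moreover have "?T (b + 2 * c') 0 = ?T ?s 2" using Suc by simp
    ultimately have "fact k \<le> ?T ?s 2 * (fact a * fact b * fact c')" by metis
    from mult_left_mono[OF this, of c] Suc show ?thesis by (simp add: algebra_simps)
  qed simp
  have "fact (a + b + c) = (a + b + c) * (fact k :: nat)"
    by (metis Suc.hyps(2) fact_Suc of_nat_id)
  also have "\<dots> = a * fact k + b * fact k + c * fact k" by (simp add: algebra_simps)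
  also have "\<dots> \<le> (?T ?s 0 + ?T ?s 1 + ?T ?s 2) * ?F"
    using a b c by (simp add: algebra_simps)
  also have "?T ?s 0 + ?T ?s 1 + ?T ?s 2 = card {n. n < 3 ^ Suc k \<and> digit_sum 3 n = ?s}"
    using card_digit_sum_Suc[of 3 k ?s] by (simp add: eval_nat_numeral)
  finally show ?case using Suc.hyps(2) by simp
qed

section \<open>Stirling-type bounds and the entropy estimate\<close>

lemma ln_fact_Suc: "ln (fact (Suc k) :: real) = ln (Suc k) + ln (fact k)"
  unfolding fact_Suc by (simp add: ln_mult del: of_nat_Suc)

text \<open>The induction step is \<open>ln (k + 1) - ln k \<le> 1 / k\<close>.\<close>

lemma ln_fact_ge: "k \<ge> 1 \<Longrightarrow> real k * ln k - k \<le> ln (fact k)"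
proof (induction k rule: dec_induct)
  case (step k)
  have "k * (ln (real (Suc k)) - ln k) \<le> k * ((real (Suc k) - k) / k)"
    using step(1) by (intro mult_left_mono ln_diff_le) auto
  with step show ?case by (simp add: ln_fact_Suc algebra_simps del: fact_Suc)
qed simp

text \<open>The induction step is \<open>ln (k + 1) - ln k \<ge> 1 / (k + 1)\<close>. The two bounds
  on \<open>fact k\<close> differ by the factor \<open>exp 1 * k\<close>, harmless on the
  exponential scale.\<close>

lemma ln_fact_le: "k \<ge> 1 \<Longrightarrow> ln (fact k) \<le> (real k + 1) * ln k - k + 1"
proof (induction k rule: dec_induct)
  case (step k)
  have "Suc k * (ln (real k) - ln (Suc k)) \<le> Suc k * ((real k - Suc k) / Suc k)"
    using step(1) by (intro mult_left_mono ln_diff_le) auto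
  with step show ?case by (simp add: ln_fact_Suc algebra_simps del: fact_Suc)
qed simp

text \<open>The exponent is \<open>Q * M\<close> times the Shannon entropy of the digit frequencies.
  The denominator collects the loss \<open>exp 1 * k * M\<close> from each of the three factorials
  bounded above.\<close>

lemma card_ternary_ge:
  fixes a b c M :: nat
  defines "Q \<equiv> a + b + c"
  assumes "a > 0" "b > 0" "c > 0" "M > 0"
  shows "exp (real M * (Q * ln Q - a * ln a - b * ln b - c * ln c)) / (exp 3 * a * b * c * real M ^ 3)
    \<le> card {n. n < 3 ^ (Q * M) \<and> digit_sum 3 n = (b + 2 * c) * M}"
    (is "exp ?h / ?D \<le> real ?T")
proof -
  have "fact (Q * M) \<le> ?T * (fact (a * M) * fact (b * M) * fact (c * M))"
    using multinomial_le_card_ternary[of "a * M" "b * M" "c * M"]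
    by (simp add: Q_def algebra_simps)
  then have "real (fact (Q * M)) \<le> real (?T * (fact (a * M) * fact (b * M) * fact (c * M)))"
    by (rule of_nat_mono)
  then have le: "fact (Q * M) \<le> ?T * (fact (a * M) * fact (b * M) * fact (c * M) :: real)"
    by simp
  have "?T \<noteq> 0"
  proof
    assume "?T = 0"
    with le have "fact (Q * M) \<le> (0 :: real)" by simp
    then show False using fact_gt_zero[of "Q * M", where 'a = real] by linarith
  qed
  have "ln (fact (Q * M)) \<le> ln (?T * (fact (a * M) * fact (b * M) * fact (c * M) :: real))"
    by (rule ln_mono[OF le]) simp
  also have "\<dots> = ln ?T + (ln (fact (a * M)) + ln (fact (b * M)) + ln (fact (c * M)))"
    using \<open>?T \<noteq> 0\<close> by (simp only: ln_mult of_nat_eq_0_iff fact_nonzero mult_eq_0_iff simp_thms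
        if_True)
  finally have "ln (fact (Q * M)) \<le> \<dots>" .
  moreover have ln_mult_M: "ln (real (k * M)) = ln k + ln M" if "k > 0" for k
    using that assms by (simp add: ln_mult)
  have "ln (fact (k * M)) \<le> (real k * M + 1) * (ln k + ln M) - real k * M + 1" if "k > 0" for k
    using ln_fact_le[of "k * M"] that assms unfolding ln_mult_M[OF that] by simp
  note this[OF \<open>a > 0\<close>] this[OF \<open>b > 0\<close>] this[OF \<open>c > 0\<close>]
  moreover have "real Q * M * (ln Q + ln M) - real Q * M \<le> ln (fact (Q * M))"
    using ln_fact_ge[of "Q * M"] ln_mult_M[of Q] assms(2-) by (simp add: Q_def)
  \<comment> \<open>Because \<open>Q = a + b + c\<close>, the terms \<open>Q * M\<close> and
    \<open>Q * M * ln M\<close> cancel against those of the three factorials.\<close>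
  moreover have "real Q * M = real a * M + real b * M + real c * M"
    by (simp add: Q_def algebra_simps)
  moreover have "real M * (Q * ln M) = M * (a * ln M) + M * (b * ln M) + M * (c * ln M)"
    by (simp add: Q_def algebra_simps)
  ultimately have "?h - (3 + ln a + ln b + ln c + 3 * ln M) \<le> ln ?T"
    by (simp add: algebra_simps)
  then have "?h - ln ?D \<le> ln ?T"
    using assms by (simp add: ln_mult ln_realpow)
  then have "exp (?h - ln ?D) \<le> exp (ln ?T)"
    by (simp only: exp_le_cancel_iff)
  moreover have "exp (ln (real ?T)) = ?T"
    using \<open>?T \<noteq> 0\<close> by (simp only: exp_ln of_nat_0_less_iff neq0_conv)
  moreover have "?D > 0" using assms by simp
  ultimately show ?thesis by (simp only: exp_diff exp_ln)
qed

section \<open>Chernoff bounds for binary digit sums\<close>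

lemma card_digit_sum_chernoff:
  fixes w y :: real
  assumes "b \<ge> 2" "y \<ge> 0" "S \<subseteq> {..<b ^ k}" "\<And>n. n \<in> S \<Longrightarrow> w \<le> y ^ digit_sum b n"
  shows "card S * w \<le> (\<Sum>d<b. y ^ d) ^ k"
proof -
  \<comment> \<open>Markov's inequality for the weight \<open>y ^ digit_sum b n\<close>:
    \<open>y > 1\<close> favours large digit sums, \<open>y < 1\<close> small ones.\<close>
  have "card S * w \<le> (\<Sum>n\<in>S. y ^ digit_sum b n)"
    using assms(4) by (rule sum_bounded_below)
  also have "\<dots> \<le> (\<Sum>n<b ^ k. y ^ digit_sum b n)"
    using assms by (intro sum_mono2) auto
  finally show ?thesis unfolding sum_power_digit_sum[OF assms(1)] .
qed

lemma card_binary_upper_tail: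
  fixes x t :: real
  assumes "x > 1"
  shows "card {n. n < 2 ^ k \<and> t \<le> digit_sum 2 n} \<le> exp (k * ln (1 + x) - t * ln x)"
proof -
  have "card {n. n < 2 ^ k \<and> t \<le> digit_sum 2 n} * x powr t \<le> (\<Sum>d<2. x ^ d) ^ k"
    using assms by (intro card_digit_sum_chernoff) (auto simp flip: powr_realpow intro!: powr_mono)
  then have "card {n. n < 2 ^ k \<and> t \<le> digit_sum 2 n} \<le> (1 + x) ^ k / x powr t"
    using assms by (simp add: field_simps numeral_2_eq_2)
  also have "\<dots> = exp (k * ln (1 + x) - t * ln x)"
    using assms by (simp add: exp_diff powr_def exp_of_nat_mult)
  finally show ?thesis .
qed

lemma card_binary_lower_tail:
  fixes x t :: real
  assumes "x > 1"
  shows "card {n. n < 2 ^ k \<and> digit_sum 2 n \<le> t} \<le> exp (k * ln (1 + x) - (k - t) * ln x)"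
proof -
  \<comment> \<open>The weight base is \<open>1 / x\<close>, so the result is the upper tail bound
    with \<open>k - t\<close> for \<open>t\<close>, as complementing binary digits suggests.\<close>
  have "card {n. n < 2 ^ k \<and> digit_sum 2 n \<le> t} * x powr (- t) \<le> (\<Sum>d<2. (1 / x) ^ d) ^ k"
    using assms
    by (intro card_digit_sum_chernoff)
      (auto simp: power_one_over powr_minus_divide simp flip: powr_realpow
        intro!: divide_left_mono powr_mono)
  also have "(\<Sum>d<2. (1 / x) ^ d) = (1 + x) / x"
    using assms by (simp add: field_simps numeral_2_eq_2)
  finally have "card {n. n < 2 ^ k \<and> digit_sum 2 n \<le> t} \<le> ((1 + x) / x) ^ k * x powr t"
    using assms by (simp add: field_simps powr_minus)
  also have "\<dots> = exp (k * (ln (1 + x) - ln x) + t * ln x)"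
    using assms by (simp add: exp_add exp_of_nat_mult powr_def exp_diff)
  finally show ?thesis by (simp add: algebra_simps)
qed

section \<open>Comparing exponential rates and passing to all large \<open>N\<close>\<close>

lemma eventually_exp_sum_less:
  fixes h s u A B C :: real
  assumes "s < h" "u < h" "C > 0"
  shows "eventually (\<lambda>M::nat. A * exp (M * s) + B * exp (M * u) < exp (M * h) / (C * real M ^ 3))
    sequentially"
proof -
  have lim: "(\<lambda>M::nat. real M ^ 3 * exp (M * v - M * h)) \<longlonglongrightarrow> 0" if "v < h" for v :: real
  proof -
    define d where "d = h - v"
    have "d > 0" using that by (simp add: d_def)
    then have "(\<lambda>M::nat. real M ^ 3 * exp (- (d * M))) \<longlonglongrightarrow> 0" by real_asymp
    then show ?thesis by (simp add: d_def algebra_simps)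
  qed
  \<comment> \<open>This is the quotient of the left side of the claim by its right side.\<close>
  have "(\<lambda>M::nat. A * C * (real M ^ 3 * exp (M * s - M * h)) +
      B * C * (real M ^ 3 * exp (M * u - M * h))) \<longlonglongrightarrow> A * C * 0 + B * C * 0"
    by (rule tendsto_add[OF tendsto_mult[OF tendsto_const lim[OF assms(1)]]
          tendsto_mult[OF tendsto_const lim[OF assms(2)]]])
  then have "eventually (\<lambda>M::nat. A * C * (real M ^ 3 * exp (M * s - M * h)) +
      B * C * (real M ^ 3 * exp (M * u - M * h)) < 1) sequentially"
    by (rule order_tendstoD) simp
  with eventually_gt_at_top[of 0] show ?thesis
  proof eventually_elim
    case (elim M)
    have "(A * exp (M * s) + B * exp (M * u)) * (C * real M ^ 3) < exp (M * h)"
      using elim(2) by (simp add: exp_diff field_simps)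
    then show ?case using elim(1) assms(3) by (simp add: pos_less_divide_eq)
  qed
qed

text \<open>The first exponential counts the candidates with ternary digit sum at its target; the
  second bounds those lost in either binary tail.\<close>

lemma card_digit_sums_close:
  fixes a b g M N :: nat and x c :: real
  defines "Q \<equiv> a + b + g" and "P \<equiv> 2 * (b + 2 * g)"
  assumes pos: "a > 0" "b > 0" "g > 0" "M > 0" and x: "x > 1" and c: "c \<ge> 0"
    and QP: "Q * ln 3 \<le> P * ln 2" and N: "2 * 3 ^ (Q * M) \<le> N"
  shows "exp (M * (Q * ln Q - a * ln a - b * ln b - g * ln g)) / (exp 3 * a * b * g * real M ^ 3)
      - 2 * (1 + x) * exp (M * (P * ln (1 + x) - (P / 2 + c * Q * ln 3) * ln x))
    \<le> card {n. 0 < n \<and> n \<le> N \<and> \<bar>real (digit_sum 3 n) - real (digit_sum 2 n)\<bar> \<le> c * ln n}"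
    (is "?E - _ \<le> real (card ?G)")
proof -
  define R where "R = {r. r < 3 ^ (Q * M) \<and> digit_sum 3 r = (b + 2 * g) * M}"
  \<comment> \<open>The leading ternary digit 1 places every candidate in
    \<open>[3 ^ (Q * M), 2 * 3 ^ (Q * M))\<close>: below \<open>N\<close>, yet with
    \<open>ln n \<ge> Q * M * ln 3\<close>, so that the fixed half-width \<open>t\<close> is at most
    \<open>c * ln n\<close>.\<close>
  define A where "A = (\<lambda>r. 3 ^ (Q * M) + r) ` R"
  define t where "t = c * Q * M * ln 3"
  \<comment> \<open>The common ternary digit sum of all candidates; the \<open>+ 1\<close> is the
    leading digit. It exceeds half the binary length \<open>P * M + 1\<close> by only
    \<open>1 / 2\<close>, which costs a constant factor in the tails.\<close>
  define m where "m = real P * M / 2 + 1"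
  define U where "U = {n. n < 2 ^ (P * M + 1) \<and> m + t \<le> digit_sum 2 n}"
  define L where "L = {n. n < 2 ^ (P * M + 1) \<and> digit_sum 2 n \<le> m - t}"
  define S where "S = P * ln (1 + x) - (P / 2 + c * Q * ln 3) * ln x"
  have cardR: "?E \<le> card R"
    unfolding R_def Q_def by (rule card_ternary_ge[OF pos])
  have cardA: "card A = card R"
    unfolding A_def by (intro card_image) simp
  have fin: "finite U" "finite L" "finite ?G" unfolding U_def L_def by simp_all
  have pow: "3 ^ (Q * M) \<le> (2 :: nat) ^ (P * M)"
  proof -
    have "(Q * M) * ln 3 \<le> (P * M) * ln (2 :: real)"
      using mult_left_mono[OF QP, of "real M"] by (simp add: ac_simps)
    then have "ln ((3 :: real) ^ (Q * M)) \<le> ln (2 ^ (P * M))"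
      by (simp add: ln_realpow)
    then have "(3 :: real) ^ (Q * M) \<le> 2 ^ (P * M)" by simp
    then show ?thesis by (simp flip: of_nat_le_iff [where 'a = real])
  qed
  have "A - (U \<union> L) \<subseteq> ?G"
  proof
    fix n assume n: "n \<in> A - (U \<union> L)"
    then obtain r where r: "n = 3 ^ (Q * M) + r" "r < 3 ^ (Q * M)"
      "digit_sum 3 r = (b + 2 * g) * M"
      unfolding A_def R_def by auto
    have "n < 2 ^ (P * M + 1)" using r pow by simp
    with n have dist: "\<bar>m - real (digit_sum 2 n)\<bar> < t"
      unfolding U_def L_def by auto
    have "digit_sum 3 n = 1 + (b + 2 * g) * M"
      using r digit_sum_leading[of 3 1 r "Q * M"] by simp
    then have m: "real (digit_sum 3 n) = m" unfolding m_def P_def by (simp add: algebra_simps)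
    have "real (3 ^ (Q * M)) \<le> real n" unfolding r(1) of_nat_le_iff by simp
    from ln_mono[OF this] have "ln (3 ^ (Q * M)) \<le> ln (real n)" by simp
    then have "c * (Q * M * ln 3) \<le> c * ln n"
      using c by (intro mult_left_mono) (simp_all add: ln_realpow)
    then have "t \<le> c * ln n" unfolding t_def by (simp add: ac_simps)
    moreover have "n \<le> N" "n > 0" using r N by auto
    ultimately show "n \<in> ?G" using m dist by simp
  qed
  then have "card (A - (U \<union> L)) \<le> card ?G" by (intro card_mono fin)
  moreover have "card A - card (U \<union> L) \<le> card (A - (U \<union> L))"
    by (intro diff_card_le_card_Diff finite_UnI fin)
  moreover have "card (U \<union> L) \<le> card U + card L" by (rule card_Un_le)
  ultimately have card: "real (card R) \<le> card ?G + (real (card U) + card L)"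
    unfolding cardA by linarith
  have lnx: "ln x \<ge> 0" using x by simp
  have "card U \<le> exp ((P * M + 1) * ln (1 + x) - (m + t) * ln x)"
    using card_binary_upper_tail[OF x, of "P * M + 1" "m + t"] unfolding U_def by simp
  also have "\<dots> = exp (M * S + ln (1 + x) - ln x)"
    unfolding S_def m_def t_def by (simp add: algebra_simps)
  also have "\<dots> \<le> exp (M * S + ln (1 + x))" using lnx by simp
  finally have U: "card U \<le> (1 + x) * exp (M * S)" using x by (simp add: exp_add ac_simps)
  have "card L \<le> exp ((P * M + 1) * ln (1 + x) - ((P * M + 1) - (m - t)) * ln x)"
    using card_binary_lower_tail[OF x, of "P * M + 1" "m - t"] unfolding L_def by simp
  also have "\<dots> = exp (M * S + ln (1 + x))"
    unfolding S_def m_def t_def by (simp add: algebra_simps)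
  finally have L: "card L \<le> (1 + x) * exp (M * S)" using x by (simp add: exp_add ac_simps)
  from cardR card U L show ?thesis unfolding S_def by (simp add: algebra_simps)
qed

lemma eventually_card_digit_sums_close:
  fixes a b g :: nat and x c e :: real
  defines "Q \<equiv> a + b + g" and "P \<equiv> 2 * (b + 2 * g)"
  defines "H \<equiv> Q * ln Q - a * ln a - b * ln b - g * ln g"
  assumes pos: "a > 0" "b > 0" "g > 0" and x: "x > 1" and c: "c \<ge> 0" and e: "e \<ge> 0"
    and QP: "Q * ln 3 \<le> P * ln 2"
    and eH: "e * Q * ln 3 < H"
    and SH: "P * ln (1 + x) - (P / 2 + c * Q * ln 3) * ln x < H"
  shows "\<exists>N0::nat. \<forall>N\<ge>N0. real N powr e <
    card {n. 0 < n \<and> n \<le> N \<and> \<bar>real (digit_sum 3 n) - real (digit_sum 2 n)\<bar> \<le> c * ln n}"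
proof -
  define S where "S = P * ln (1 + x) - (P / 2 + c * Q * ln 3) * ln x"
  \<comment> \<open>\<open>K\<close> is \<open>(2 * 3 ^ Q) powr e\<close>: it pays for the constant
    2 and for rounding \<open>N\<close> down to a complete block of \<open>Q\<close> ternary
    digits.\<close>
  define K where "K = exp (e * (ln 2 + Q * ln 3))"
  have Q: "Q > 0" using pos unfolding Q_def by simp
  have "eventually (\<lambda>M::nat. K * exp (M * (e * Q * ln 3)) + 2 * (1 + x) * exp (M * S)
      < exp (M * H) / (exp 3 * a * b * g * real M ^ 3)) sequentially"
    using pos eH SH unfolding S_def by (intro eventually_exp_sum_less) auto
  then obtain M0 where M0: "K * exp (M * (e * Q * ln 3)) + 2 * (1 + x) * exp (M * S)
      < exp (M * H) / (exp 3 * a * b * g * real M ^ 3)" if "M \<ge> M0" for M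
    unfolding eventually_sequentially by blast
  show ?thesis
  \<comment> \<open>This threshold forces the maximal \<open>M\<close> to be at least
    \<open>Suc M0\<close>, hence both large enough and positive.\<close>
  proof (intro exI[of _ "2 * 3 ^ (Q * Suc M0)"] allI impI)
    fix N :: nat assume N: "N \<ge> 2 * 3 ^ (Q * Suc M0)"
    let ?P = "\<lambda>M. 2 * 3 ^ (Q * M) \<le> N"
    have bound: "M \<le> N" if "?P M" for M
    proof -
      have "M \<le> Q * M" using Q by simp
      also have "\<dots> < 3 ^ (Q * M)" by (rule power_gt_expt) simp
      finally show ?thesis using that by linarith
    qed
    define M where "M = (GREATEST M. ?P M)"
    have "?P M" unfolding M_def using N bound by (rule GreatestI_nat)
    have "M \<ge> Suc M0" unfolding M_def using N bound by (rule Greatest_le_nat)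
    have "\<not> ?P (Suc M)"
    proof
      assume "?P (Suc M)"
      then have "Suc M \<le> M" unfolding M_def using bound by (rule Greatest_le_nat)
      then show False by simp
    qed
    then have "real N \<le> real (2 * 3 ^ (Q * Suc M))" by (intro of_nat_mono) simp
    then have "real N powr e \<le> real (2 * 3 ^ (Q * Suc M)) powr e"
      using e by (intro powr_mono2) auto
    also have "\<dots> = exp (e * (ln 2 + (Q * Suc M) * ln 3))"
      by (simp add: powr_def ln_mult ln_realpow del: power_Suc)
    also have "\<dots> = K * exp (M * (e * Q * ln 3))"
      unfolding K_def by (simp add: algebra_simps flip: exp_add)
    also have "\<dots> < exp (M * H) / (exp 3 * a * b * g * real M ^ 3) - 2 * (1 + x) * exp (M * S)"
      using M0[of M] \<open>M \<ge> Suc M0\<close> by linarith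
    also have "\<dots> \<le> card {n. 0 < n \<and> n \<le> N \<and>
        \<bar>real (digit_sum 3 n) - real (digit_sum 2 n)\<bar> \<le> c * ln n}"
      using card_digit_sums_close[OF pos _ x c QP[unfolded Q_def P_def] \<open>?P M\<close>[unfolded Q_def]]
        \<open>M \<ge> Suc M0\<close>
      unfolding S_def H_def Q_def P_def by simp
    finally show "real N powr e < \<dots>" .
  qed
qed

section \<open>Numerical bounds on logarithms\<close>

lemma ln_2_bounds: "ln (2 :: real) \<in> {0.693147180558..0.693147180562}"
  using ln_approx_bounds[of "2" 13] by (simp add: eval_nat_numeral)

lemma ln_3_half_bounds: "ln (3/2 :: real) \<in> {0.405465108107..0.405465108111}"
  using ln_approx_bounds[of "3/2" 10] by (simp add: eval_nat_numeral)

lemma ln_15601_15552_bounds: "ln (15601/15552 :: real) \<in> {0.003145767046..0.003145767050}"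
  using ln_approx_bounds[of "15601/15552" 2] by (simp add: eval_nat_numeral)

lemma ln_864_863_bounds: "ln (864/863 :: real) \<in> {0.001158077719..0.001158077723}"
  using ln_approx_bounds[of "864/863" 2] by (simp add: eval_nat_numeral)

lemma ln_20122_19683_bounds: "ln (20122/19683 :: real) \<in> {0.022058424838..0.022058424842}"
  using ln_approx_bounds[of "20122/19683" 3] by (simp add: eval_nat_numeral)

lemma ln_59049_58664_bounds: "ln (59049/58664 :: real) \<in> {0.006541356906..0.006541356910}"
  using ln_approx_bounds[of "59049/58664" 3] by (simp add: eval_nat_numeral)

lemma ln_241_240_bounds: "ln (241/240 :: real) \<in> {0.004158010147..0.004158010151}"
  using ln_approx_bounds[of "241/240" 2] by (simp add: eval_nat_numeral)

lemma ln_405_401_bounds: "ln (405/401 :: real) \<in> {0.009925639798..0.009925639802}"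
  using ln_approx_bounds[of "405/401" 3] by (simp add: eval_nat_numeral)

theorem theorem2:
  shows "\<exists>N0::nat. \<forall>N::nat. N \<ge> N0 \<longrightarrow>
    real (card {n::nat. 0 < n \<and> n \<le> N \<and>
      \<bar>real (digit_sum 3 n) - real (digit_sum 2 n)\<bar> \<le> 0.1457205 * ln (real n)})
    > real N powr 0.970359"
proof -
  have ln3: "ln (3 :: real) = ln 2 + ln (3/2)"
    by (simp add: ln_div)
  \<comment> \<open>Each argument below is a product of powers of 2 and 3, possibly negative, times
    a quotient close to 1 or its inverse; the series for the logarithm of such a quotient needs only
    two or three terms.\<close>
  have lnQ: "ln (31202 :: real) = 7 * ln 2 + 5 * ln 3 + ln (15601/15552)"
    using ln_realpow[of 2 7] ln_realpow[of 3 5] ln_mult[of "2 ^ 7 * 3 ^ 5" "15601/15552 :: real"]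
      ln_mult[of "2 ^ 7" "3 ^ 5 :: real"] by simp
  have lna: "ln (13808 :: real) = 9 * ln 2 + 3 * ln 3 - ln (864/863)"
    using ln_realpow[of 2 9] ln_realpow[of 3 3] ln_div[of "2 ^ 9 * 3 ^ 3" "864/863 :: real"]
      ln_mult[of "2 ^ 9" "3 ^ 3 :: real"] by simp
  have lnb: "ln (10061 :: real) = 9 * ln 3 - ln 2 + ln (20122/19683)"
    using ln_realpow[of 3 9] ln_div[of "3 ^ 9" "2 :: real"]
      ln_mult[of "3 ^ 9 / 2" "20122/19683 :: real"] by simp
  have lng: "ln (7333 :: real) = 10 * ln 3 - 3 * ln 2 - ln (59049/58664)"
    using ln_realpow[of 3 10] ln_realpow[of 2 3] ln_div[of "3 ^ 10" "2 ^ 3 :: real"]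
      ln_div[of "3 ^ 10 / 2 ^ 3" "59049/58664 :: real"] by simp
  have lnx: "ln (241/160 :: real) = ln (3/2) + ln (241/240)"
    using ln_mult[of "3/2" "241/240 :: real"] by simp
  have ln1x: "ln (401/160 :: real) = 4 * ln 3 - 5 * ln 2 - ln (405/401)"
    using ln_realpow[of 3 4] ln_realpow[of 2 5] ln_div[of "3 ^ 4" "2 ^ 5 :: real"]
      ln_div[of "3 ^ 4 / 2 ^ 5" "405/401 :: real"] by simp
  note bounds = ln_2_bounds ln_3_half_bounds ln_15601_15552_bounds ln_864_863_bounds
    ln_20122_19683_bounds ln_59049_58664_bounds ln_241_240_bounds ln_405_401_bounds
  \<comment> \<open>The only product of two logarithms in the final inequalities. Once it is named,
    they are linear in bounded quantities; it enters with a negative sign, so a lower bound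
    suffices.\<close>
  define p :: real where "p = ln 3 * ln (241/160)"
  have p: "1.098612288665 * 0.409623118254 \<le> p"
    unfolding p_def ln3 lnx using bounds by (intro mult_mono) auto
  have expand: "(real (2 * (10061 + 2 * 7333)) / 2 + 0.1457205 * real (13808 + 10061 + 7333) * ln 3)
      * ln (241/160) = 24727 * ln (241/160) + 0.1457205 * 31202 * p"
    unfolding p_def by (simp add: algebra_simps)
  have "\<exists>N0::nat. \<forall>N\<ge>N0. real N powr 0.970359 <
    card {n. 0 < n \<and> n \<le> N \<and>
      \<bar>real (digit_sum 3 n) - real (digit_sum 2 n)\<bar> \<le> 0.1457205 * ln n}"
    \<comment> \<open>Here \<open>P / Q = 24727 / 15601\<close> is a convergent of \<open>log\<^sub>2 3\<close> from above. The digit counts and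
      \<open>x = 241/160\<close> are near the optimum; the last inequality below holds with a margin of only
      about \<open>0.00035\<close>, whence the twelve-digit bounds on logarithms.\<close>
  proof (rule eventually_card_digit_sums_close[of 13808 10061 7333 "241/160"])
    \<comment> \<open>The convergent appears with numerator and denominator doubled, as
      \<open>P = 2 * (b + 2 * g)\<close> is even and 24727 is odd.\<close>
    show "real (13808 + 10061 + 7333) * ln 3 \<le> real (2 * (10061 + 2 * 7333)) * ln 2"
      using bounds by (simp add: ln3)
    show "0.970359 * real (13808 + 10061 + 7333) * ln 3 <
        real (13808 + 10061 + 7333) * ln (real (13808 + 10061 + 7333)) - real 13808 * ln (real 13808)
        - real 10061 * ln (real 10061) - real 7333 * ln (real 7333)"
      using bounds by (simp add: lnQ lna lnb lng) (simp add: ln3)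
    show "real (2 * (10061 + 2 * 7333)) * ln (1 + 241/160) -
        (real (2 * (10061 + 2 * 7333)) / 2 + 0.1457205 * real (13808 + 10061 + 7333) * ln 3)
          * ln (241/160)
      < real (13808 + 10061 + 7333) * ln (real (13808 + 10061 + 7333)) - real 13808 * ln (real 13808)
        - real 10061 * ln (real 10061) - real 7333 * ln (real 7333)"
      unfolding expand using bounds p
      by (simp add: lnQ lna lnb lng ln1x) (simp add: ln3 lnx)
  qed simp_all
  then show ?thesis by blast
qed

end
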